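(* Let $n\ge 2$ and let $P=(p_1,\dots,p_n)$ and $Q=(q_1,\dots,q_n)$ be elements of $\Gamma_n$. Then $$0\le F(P\|Q)\le \frac{4}{27}\,J(P\|Q).$$
   Context: $\Gamma_n=\{P=(p_1,\dots,p_n): p_i>0,\ \sum_{i=1}^n p_i=1\}$ is the set of finite discrete probability distributions with strictly positive entries. $\ln$ is the natural logarithm. The relative Jensen-Shannon divergence is $F(P\|Q)=\sum_{i=1}^n p_i\ln\left(\frac{2p_i}{p_i+q_i}\right)$. The J-divergence is $J(P\|Q)=\sum_{i=1}^n (p_i-q_i)\ln\left(\frac{p_i}{q_i}\right)$. *)

theory Defs
  imports "HOL-Analysis.Analysis"
begin

text \<open>The index type \<open>'n\<close> plays the role of \<open>{1, ..., n}\<close>, with \<open>n = CARD('n)\<close>.\<close>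

definition pos_distributions :: "(real ^ 'n) set"  (\<open>\<Gamma>\<close>) where
  "\<Gamma> = {P. (\<forall>i. P $ i > 0) \<and> (\<Sum>i\<in>UNIV. P $ i) = 1}"

definition relative_JS_divergence :: "real ^ 'n \<Rightarrow> real ^ 'n \<Rightarrow> real" where
  "relative_JS_divergence P Q = (\<Sum>i\<in>UNIV. P $ i * ln (2 * P $ i / (P $ i + Q $ i)))"

definition J_divergence :: "real ^ 'n \<Rightarrow> real ^ 'n \<Rightarrow> real" where
  "J_divergence P Q = (\<Sum>i\<in>UNIV. (P $ i - Q $ i) * ln (P $ i / Q $ i))"

end

theory Submission
  imports Defs
begin

text \<open>
  Both bounds hold term by term up to a multiple of \<open>p - q\<close>, which sums to zero. Writing
  \<open>x = p / q\<close>, the generators \<open>x ln (2x / (x + 1))\<close> of \<open>F\<close> and \<open>(x - 1) ln x\<close> of \<open>J\<close> have second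
  derivatives \<open>1 / (x (x + 1)^2)\<close> and \<open>(x + 1) / x^2\<close>. Their quotient \<open>x / (x + 1)^3\<close> has maximum
  \<open>4/27\<close>, attained at \<open>x = 1/2\<close>, so \<open>4/27\<close> times the second generator minus the first one is
  convex and lies above its tangent at \<open>x = 1\<close>.
\<close>

text \<open>This is \<open>ln t \<le> t - 1\<close> at \<open>t = (p + q) / (2 * p)\<close>, the
  reciprocal of the argument of the logarithm.\<close>

lemma mult_ln_ge_half_diff:
  fixes p q :: real
  assumes "p > 0" "q > 0"
  shows "(p - q) / 2 \<le> p * ln (2 * p / (p + q))"
proof -
  have "ln ((p + q) / (2 * p)) \<le> (p + q) / (2 * p) - 1"
    using assms by (intro ln_le_minus_one) simp
  moreover have "ln ((p + q) / (2 * p)) = - ln (2 * p / (p + q))"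
    using assms by (simp add: ln_div)
  ultimately have "1 - (p + q) / (2 * p) \<le> ln (2 * p / (p + q))"
    by simp
  then have "p * (1 - (p + q) / (2 * p)) \<le> p * ln (2 * p / (p + q))"
    using assms by (intro mult_left_mono) auto
  moreover have "p * (1 - (p + q) / (2 * p)) = (p - q) / 2"
    using assms by (simp add: field_simps)
  ultimately show ?thesis by simp
qed

lemma generator_upper_bound:
  fixes x :: real
  assumes "x > 0"
  shows "x * ln (2 * x / (x + 1)) \<le> 4 / 27 * ((x - 1) * ln x) + (x - 1) / 2"
proof -
  \<comment> \<open>The logarithm of the quotient is split, which is valid for \<open>x > 0\<close>,
    so that \<open>h\<close> can be differentiated term by term.\<close>
  define h where "h = (\<lambda>x::real. 4 / 27 * ((x - 1) * ln x) - x * (ln 2 + ln x - ln (x + 1)))"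
  define h' where
    "h' = (\<lambda>x::real. 4 / 27 * (ln x + 1 - 1 / x) - (ln 2 + ln x - ln (x + 1)) - 1 / (x + 1))"
  define h'' where "h'' = (\<lambda>x::real. 4 / 27 * (1 / x + 1 / x ^ 2) - 1 / x + 1 / (x + 1) + 1 / (x + 1) ^ 2)"
  have h': "(h has_real_derivative h' y) (at y)" if "y > 0" for y
    unfolding h_def h'_def using that
    by (auto intro!: derivative_eq_intros) (simp add: divide_simps add_nonneg_eq_0_iff, simp add: algebra_simps)
  have h'': "(h' has_real_derivative h'' y) (at y)" if "y > 0" for y
    unfolding h'_def h''_def using that
    by (auto intro!: derivative_eq_intros) (simp add: field_simps power2_eq_square)
  have h''_nonneg: "h'' y \<ge> 0" if "y > 0" for y
  proof -
    \<comment> \<open>The numerator is \<open>4 * (y + 1) ^ 3 - 27 * y\<close>; maximality of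
      \<open>4 / 27\<close> at \<open>y = 1 / 2\<close> makes that point a double root.\<close>
    have "h'' y = (2 * y - 1) ^ 2 * (y + 4) / (27 * y ^ 2 * (y + 1) ^ 2)"
      unfolding h''_def using that by (simp add: divide_simps) algebra
    with that show ?thesis by simp
  qed
  have "convex_on {0<..} h"
    by (rule f''_ge0_imp_convex[where f' = h' and f'' = h''])
      (auto intro: h' h'' h''_nonneg)
  \<comment> \<open>Here \<open>h 1 = 0\<close> and \<open>h' 1 = - 1 / 2\<close>, whence the term
    \<open>(x - 1) / 2\<close> of the bound.\<close>
  then have "h x - h 1 \<ge> h' 1 * (x - 1)"
    using assms h'[of 1]
    by (intro convex_on_imp_above_tangent[where A = "{0<..}"])
      (auto simp: interior_open intro: has_field_derivative_at_within)
  moreover have "ln (2 * x / (x + 1)) = ln 2 + ln x - ln (x + 1)"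
    using assms by (simp add: ln_div ln_mult)
  ultimately show ?thesis
    by (simp add: h_def h'_def)
qed

text \<open>Both sides are homogeneous of degree 1 in \<open>(p, q)\<close>, so the bound is
  \<open>q\<close> times the one-variable bound at \<open>x = p / q\<close>.\<close>

lemma mult_ln_le_J_term:
  fixes p q :: real
  assumes "p > 0" "q > 0"
  shows "p * ln (2 * p / (p + q)) \<le> 4 / 27 * ((p - q) * ln (p / q)) + (p - q) / 2"
proof -
  have eq: "2 * (p / q) / (p / q + 1) = 2 * p / (p + q)"
    using assms by (simp add: divide_simps)
  have "q * (p / q * ln (2 * (p / q) / (p / q + 1)))
      \<le> q * (4 / 27 * ((p / q - 1) * ln (p / q)) + (p / q - 1) / 2)"
    using assms by (intro mult_left_mono generator_upper_bound) auto
  also have "\<dots> = 4 / 27 * ((q * (p / q - 1)) * ln (p / q)) + q * (p / q - 1) / 2"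
    by (simp add: algebra_simps)
  also have "q * (p / q - 1) = p - q"
    using assms by (simp add: field_simps)
  finally show ?thesis
    using assms unfolding eq by simp
qed

theorem proposition5p2:
  fixes P Q :: "real ^ 'n"
  assumes "CARD('n) \<ge> 2"
    and "P \<in> \<Gamma>" and "Q \<in> \<Gamma>"
  shows "0 \<le> relative_JS_divergence P Q
    \<and> relative_JS_divergence P Q \<le> 4 / 27 * J_divergence P Q"
proof
  have pos: "P $ i > 0" "Q $ i > 0" for i
    using assms by (auto simp: pos_distributions_def)
  \<comment> \<open>The same linear correction occurs in the lower and the upper bound, so its
    vanishing serves both.\<close>
  have "(\<Sum>i\<in>UNIV. (P $ i - Q $ i) / 2) = ((\<Sum>i\<in>UNIV. P $ i) - (\<Sum>i\<in>UNIV. Q $ i)) / 2"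
    by (simp add: sum_subtractf flip: sum_divide_distrib)
  then have zero: "(\<Sum>i\<in>UNIV. (P $ i - Q $ i) / 2) = 0"
    using assms by (simp add: pos_distributions_def)
  have "(\<Sum>i\<in>UNIV. (P $ i - Q $ i) / 2) \<le> relative_JS_divergence P Q"
    unfolding relative_JS_divergence_def by (intro sum_mono mult_ln_ge_half_diff pos)
  with zero show "0 \<le> relative_JS_divergence P Q" by simp
  have "relative_JS_divergence P Q
      \<le> (\<Sum>i\<in>UNIV. 4 / 27 * ((P $ i - Q $ i) * ln (P $ i / Q $ i)) + (P $ i - Q $ i) / 2)"
    unfolding relative_JS_divergence_def by (intro sum_mono mult_ln_le_J_term pos)
  also have "\<dots> = 4 / 27 * J_divergence P Q"
    unfolding J_divergence_def sum.distrib zero by (simp only: sum_distrib_left add_0_right)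
  finally show "relative_JS_divergence P Q \<le> 4 / 27 * J_divergence P Q" .
qed

end
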